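(* Let $L$ be an MV-algebra and let $d$ be an additive derivation on $L$. Let $Fix_d(L)=\{x\in L\mid d(x)=x\}$. Then $(Fix_d(L),\oplus,\neg,0)$ is an MV-algebra, where $\oplus$ and $0$ are those of $L$ and $\neg x=d(x^\ast)=d(1)\odot x^\ast=(x\oplus (d(1))^\ast)^\ast$ for any $x\in Fix_d(L)$.
   Context: An MV-algebra is an algebra $(L,\oplus,{}^\ast,0)$ of type $(2,1,0)$ such that $(L,\oplus,0)$ is a commutative monoid, $(x^\ast)^\ast=x$, $0^\ast\oplus x=0^\ast$, and $(x^\ast\oplus y)^\ast\oplus y=(y^\ast\oplus x)^\ast\oplus x$ for all $x,y\in L$. Put $1=0^\ast$ and $x\odot y=(x^\ast\oplus y^\ast)^\ast$. A derivation on $L$ is a map $d:L\to L$ with $d(x\odot y)=(d(x)\odot y)\oplus(x\odot d(y))$ for all $x,y\in L$. It is additive if $d(x\oplus y)=d(x)\oplus d(y)$ for all $x,y\in L$. *)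

theory Defs
  imports "HOL-Algebra.Group"
begin

locale mv_algebra =
  fixes L :: "'a set"
    and oplus :: "'a \<Rightarrow> 'a \<Rightarrow> 'a" (infixl "\<oplus>" 65)
    and star :: "'a \<Rightarrow> 'a"
    and zero :: 'a
  assumes oplus_comm_monoid: "comm_monoid \<lparr>carrier = L, mult = (\<oplus>), one = zero\<rparr>"
    and star_closed: "x \<in> L \<Longrightarrow> star x \<in> L"
    and star_star: "x \<in> L \<Longrightarrow> star (star x) = x"
    and star_zero_oplus: "x \<in> L \<Longrightarrow> star zero \<oplus> x = star zero"
    and lukasiewicz:
      "\<lbrakk>x \<in> L; y \<in> L\<rbrakk> \<Longrightarrow> star (star x \<oplus> y) \<oplus> y = star (star y \<oplus> x) \<oplus> x"

definition mv_one :: "('a \<Rightarrow> 'a) \<Rightarrow> 'a \<Rightarrow> 'a" where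
  "mv_one star zero = star zero"

definition mv_odot :: "('a \<Rightarrow> 'a \<Rightarrow> 'a) \<Rightarrow> ('a \<Rightarrow> 'a) \<Rightarrow> 'a \<Rightarrow> 'a \<Rightarrow> 'a" where
  "mv_odot oplus star x y = star (oplus (star x) (star y))"

definition mv_derivation ::
  "'a set \<Rightarrow> ('a \<Rightarrow> 'a \<Rightarrow> 'a) \<Rightarrow> ('a \<Rightarrow> 'a) \<Rightarrow> ('a \<Rightarrow> 'a) \<Rightarrow> bool" where
  "mv_derivation L oplus star d \<longleftrightarrow>
     d \<in> L \<rightarrow> L \<and>
     (\<forall>x\<in>L. \<forall>y\<in>L. d (mv_odot oplus star x y) =
        oplus (mv_odot oplus star (d x) y) (mv_odot oplus star x (d y)))"

definition mv_additive :: "'a set \<Rightarrow> ('a \<Rightarrow> 'a \<Rightarrow> 'a) \<Rightarrow> ('a \<Rightarrow> 'a) \<Rightarrow> bool" where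
  "mv_additive L oplus d \<longleftrightarrow> (\<forall>x\<in>L. \<forall>y\<in>L. d (oplus x y) = oplus (d x) (d y))"

definition Fix_set :: "'a set \<Rightarrow> ('a \<Rightarrow> 'a) \<Rightarrow> 'a set" where
  "Fix_set L d = {x \<in> L. d x = x}"

end

theory Submission
  imports Defs
begin

text \<open>
  Put \<open>e = d 1\<close>. Additivity gives \<open>e \<oplus> e = e\<close>, so \<open>e\<close> is Boolean. Expanding \<open>d (x \<odot> x\<^sup>*) = 0\<close> and
  \<open>d (x \<odot> 1)\<close> yields \<open>d x \<le> x\<close> and \<open>e \<odot> x \<le> d x\<close>, while additivity yields \<open>d x \<le> e\<close>; since \<open>e\<close> is
  Boolean these force \<open>d x = e \<odot> x\<close>. Consequently \<open>d (e\<^sup>*) = 0\<close>, whence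
  \<open>d ((d x)\<^sup>*) = d (e\<^sup>* \<oplus> x\<^sup>*) = d (x\<^sup>*)\<close>, and the MV-axioms for the fixed points follow by applying
  \<open>d\<close> to those of \<open>L\<close>.
\<close>

context mv_algebra
begin

lemmas oplus_monoid = comm_monoid.axioms(1)[OF oplus_comm_monoid]

lemma zero_closed: "zero \<in> L"
  using monoid.one_closed[OF oplus_monoid] by simp

lemma oplus_closed: "x \<in> L \<Longrightarrow> y \<in> L \<Longrightarrow> x \<oplus> y \<in> L"
  using monoid.m_closed[OF oplus_monoid] by simp

lemma oplus_assoc: "x \<in> L \<Longrightarrow> y \<in> L \<Longrightarrow> z \<in> L \<Longrightarrow> x \<oplus> y \<oplus> z = x \<oplus> (y \<oplus> z)"
  using monoid.m_assoc[OF oplus_monoid] by simp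

lemma oplus_comm: "x \<in> L \<Longrightarrow> y \<in> L \<Longrightarrow> x \<oplus> y = y \<oplus> x"
  using comm_monoid.m_comm[OF oplus_comm_monoid] by simp

lemma zero_oplus: "x \<in> L \<Longrightarrow> zero \<oplus> x = x"
  using monoid.l_one[OF oplus_monoid] by simp

lemma oplus_zero: "x \<in> L \<Longrightarrow> x \<oplus> zero = x"
  using oplus_comm zero_closed zero_oplus by simp

lemma oplus_star_zero: "x \<in> L \<Longrightarrow> x \<oplus> star zero = star zero"
  using oplus_comm star_closed zero_closed star_zero_oplus by simp

lemmas closed = zero_closed oplus_closed star_closed

lemma star_oplus: "x \<in> L \<Longrightarrow> star x \<oplus> x = star zero"
  \<comment> \<open>With \<open>star zero\<close> as first argument, one side collapses to
    \<open>star x \<oplus> x\<close> and the other ends in the absorbing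
    \<open>star zero\<close>.\<close>
  using lukasiewicz[of "star zero" x]
  by (simp add: closed star_star zero_oplus star_zero_oplus oplus_star_zero)

lemma oplus_star: "x \<in> L \<Longrightarrow> x \<oplus> star x = star zero"
  using star_oplus oplus_comm closed by simp

text \<open>The natural order \<open>x \<le> y\<close> is written as \<open>star x \<oplus> y = star zero\<close>.\<close>

lemma le_witness:
  assumes "x \<in> L" "y \<in> L" "star x \<oplus> y = star zero"
  shows "star (star y \<oplus> x) \<oplus> x = y"
  using lukasiewicz[of x y] assms by (simp add: star_star closed zero_oplus)

lemma le_antisym:
  assumes "x \<in> L" "y \<in> L" "star x \<oplus> y = star zero" "star y \<oplus> x = star zero"
  shows "x = y"
  using le_witness[of x y] assms by (simp add: star_star closed zero_oplus)

lemma le_oplus: "x \<in> L \<Longrightarrow> y \<in> L \<Longrightarrow> star x \<oplus> (x \<oplus> y) = star zero"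
  by (simp add: oplus_assoc[symmetric] closed star_oplus star_zero_oplus)

lemma star_idempotent:
  assumes e: "e \<in> L" and ee: "e \<oplus> e = e"
  shows "star e \<oplus> star e = star e"
proof (rule le_antisym)
  show "star (star e \<oplus> star e) \<oplus> star e = star zero"
    \<comment> \<open>By \<open>ee\<close>, one side of the identity is
      \<open>star e \<oplus> e\<close>, that is, \<open>star zero\<close>; the other side is the
      goal.\<close>
    using lukasiewicz[of "star e" e] e ee by (simp add: star_star closed star_oplus)
  show "star (star e) \<oplus> (star e \<oplus> star e) = star zero"
    using e by (simp add: le_oplus closed)
qed (use e closed in auto)

text \<open>From \<open>y\<close> \<le> \<open>e\<close>, \<open>star y\<close> has
  \<open>star e\<close> as a summand, and the idempotent \<open>star e\<close> absorbs a further
  copy of itself.\<close>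

lemma le_idempotent:
  assumes "e \<in> L" "y \<in> L" "e \<oplus> e = e" "star y \<oplus> e = star zero"
  shows "star e \<oplus> star y = star y"
proof -
  let ?c = "star (y \<oplus> star e)"
  have "star (star (star e) \<oplus> star y) \<oplus> star y = star (star (star y) \<oplus> star e) \<oplus> star e"
    using assms lukasiewicz closed by blast
  then have y: "star y = ?c \<oplus> star e"
    using assms by (simp add: star_star closed oplus_comm[of e "star y"] zero_oplus)
  have "?c \<oplus> star e \<oplus> star e = ?c \<oplus> star e"
    using assms by (simp add: oplus_assoc closed star_idempotent)
  with y show ?thesis
    using assms by (metis oplus_comm star_closed)
qed

end

locale mv_additive_derivation = mv_algebra +
  fixes d :: "'a \<Rightarrow> 'a"
  assumes derivation: "mv_derivation L oplus star d"
    and additive: "mv_additive L oplus d"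
begin

abbreviation e where "e \<equiv> d (star zero)"

lemma d_closed: "x \<in> L \<Longrightarrow> d x \<in> L"
  using derivation by (auto simp: mv_derivation_def)

lemma d_oplus: "x \<in> L \<Longrightarrow> y \<in> L \<Longrightarrow> d (x \<oplus> y) = d x \<oplus> d y"
  using additive by (auto simp: mv_additive_def)

lemma d_odot:
  "x \<in> L \<Longrightarrow> y \<in> L \<Longrightarrow>
    d (star (star x \<oplus> star y)) = star (star (d x) \<oplus> star y) \<oplus> star (star x \<oplus> star (d y))"
  using derivation by (auto simp: mv_derivation_def mv_odot_def)

lemma d_zero: "d zero = zero"
  using d_odot[of zero zero]
  by (simp add: closed d_closed star_star star_zero_oplus oplus_star_zero zero_oplus)

lemma e_idempotent: "e \<oplus> e = e"
  using d_oplus[of "star zero" "star zero"] by (simp add: closed star_zero_oplus)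

lemma d_le_e: "x \<in> L \<Longrightarrow> star (d x) \<oplus> e = star zero"
  using d_oplus[of x "star x"] by (simp add: closed d_closed oplus_star le_oplus)

lemma d_le:
  assumes x: "x \<in> L"
  shows "star (d x) \<oplus> x = star zero"
proof -
  let ?a = "star (star (d x) \<oplus> x)" and ?b = "star (star x \<oplus> star (d (star x)))"
  have ab: "?a \<oplus> ?b = zero"
    using d_odot[of x "star x"] x by (simp add: closed star_star star_oplus d_zero)
  \<comment> \<open>\<open>?a\<close> lies below a sum equal to \<open>zero\<close>, so it vanishes;
    its complement is the left side of the goal.\<close>
  have "star ?a \<oplus> (?a \<oplus> ?b) = star zero"
    using x by (intro le_oplus) (simp_all add: closed d_closed)
  then show ?thesis
    using x ab by (simp add: closed d_closed star_star oplus_zero)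
qed

lemma odot_e_le_d:
  assumes x: "x \<in> L"
  shows "star (star (star e \<oplus> star x)) \<oplus> d x = star zero"
proof -
  let ?o = "star (star e \<oplus> star x)"
  have "d x = ?o \<oplus> d x"
    using d_odot[of "star zero" x] x
    by (simp add: closed d_closed star_star zero_oplus)
  then show ?thesis
    using le_oplus[of ?o "d x"] x by (simp add: closed d_closed)
qed

lemma d_eq_odot:
  assumes x: "x \<in> L"
  shows "d x = star (star e \<oplus> star x)"
proof (rule le_antisym)
  have dx: "d x \<in> L" "star x \<in> L" "star e \<in> L" "star (d x) \<in> L"
    using x by (simp_all add: closed d_closed)
  \<comment> \<open>The difference between \<open>star (d x)\<close> and the smaller
    \<open>star x\<close>, as supplied by \<open>le_witness\<close>.\<close>
  define c where "c = star (star (star (d x)) \<oplus> star x)"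
  have c: "c \<in> L"
    using dx by (simp add: c_def closed)
  have "c \<oplus> star x = star (d x)"
    unfolding c_def using le_witness[of "star x" "star (d x)"] d_le[OF x] x dx
    by (simp add: closed star_star oplus_comm)
  then have "star (d x) = star e \<oplus> star x \<oplus> c"
    using le_idempotent[of e "d x"] e_idempotent d_le_e[OF x] dx c
    by (metis d_closed oplus_assoc oplus_comm star_closed zero_closed)
  \<comment> \<open>\<open>star (d x)\<close> now contains \<open>star e \<oplus> star x\<close>, so
    adding the complement of that summand yields \<open>star zero\<close>.\<close>
  then have "star (d x) \<oplus> star (star e \<oplus> star x) =
      star (star e \<oplus> star x) \<oplus> ((star e \<oplus> star x) \<oplus> c)"
    using dx c by (simp add: closed oplus_comm)
  then show "star (d x) \<oplus> star (star e \<oplus> star x) = star zero"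
    using le_oplus[of "star e \<oplus> star x" c] dx c by (simp add: closed)
qed (use x odot_e_le_d closed d_closed in auto)

lemma d_star_e: "d (star e) = zero"
  using d_eq_odot[of "star e"] by (simp add: closed d_closed star_star star_oplus)

text \<open>Serves to reduce nested negations in the fixed-point algebra to those of
  \<open>L\<close>.\<close>

lemma d_star_d:
  assumes x: "x \<in> L"
  shows "d (star (d x)) = d (star x)"
proof -
  have "star (d x) = star e \<oplus> star x"
    by (subst d_eq_odot[OF x]) (simp add: x closed d_closed star_star)
  then show ?thesis
    using x by (simp add: d_oplus closed d_closed d_star_e zero_oplus)
qed

text \<open>In \<open>d (star (d (star (d x))))\<close>, dropping the middle \<open>d\<close> leaves
  \<open>d (d x)\<close>; dropping the innermost one and then the middle one leaves
  \<open>d x\<close>.\<close>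

lemma d_d: "x \<in> L \<Longrightarrow> d (d x) = d x"
  using d_star_d[of "star (d x)"] d_star_d[of x] d_star_d[of "star x"]
  by (simp add: closed d_closed star_star)

lemma Fix_mv_algebra: "mv_algebra (Fix_set L d) oplus (\<lambda>x. d (star x)) zero"
proof (rule mv_algebra.intro)
  fix x y assume "x \<in> Fix_set L d" and "y \<in> Fix_set L d"
  then have xy: "x \<in> L" "d x = x" "y \<in> L" "d y = y"
    by (auto simp: Fix_set_def)
  \<comment> \<open>As \<open>b\<close> is fixed, additivity moves it under \<open>d\<close>, so
    each side of the new identity is \<open>d\<close> of the corresponding side in
    \<open>L\<close>.\<close>
  have *: "d (star (d (star a) \<oplus> b)) \<oplus> b = d (star (star a \<oplus> b) \<oplus> b)"
    if "a \<in> L" "b \<in> L" "d b = b" for a b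
  proof -
    have "d (star a) \<oplus> b = d (star a \<oplus> b)"
      using that by (simp add: d_oplus closed)
    then have "d (star (d (star a) \<oplus> b)) = d (star (star a \<oplus> b))"
      using that by (simp only: d_star_d closed)
    then show ?thesis
      using that by (simp add: d_oplus closed)
  qed
  show "d (star (d (star x) \<oplus> y)) \<oplus> y = d (star (d (star y) \<oplus> x)) \<oplus> x"
    using xy by (simp add: * lukasiewicz)
next
  show "comm_monoid \<lparr>carrier = Fix_set L d, mult = (\<oplus>), one = zero\<rparr>"
    by (rule comm_monoidI)
      (auto simp: Fix_set_def closed d_oplus d_zero oplus_assoc zero_oplus intro: oplus_comm)
next
  fix x assume "x \<in> Fix_set L d"
  then have x: "x \<in> L" "d x = x"
    by (auto simp: Fix_set_def)
  show "d (star x) \<in> Fix_set L d"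
    using x by (simp add: Fix_set_def closed d_closed d_d)
  show "d (star (d (star x))) = x"
    using x by (simp add: d_star_d closed star_star)
  \<comment> \<open>The new negation sends \<open>zero\<close> to \<open>e\<close>, which is
    therefore the top element among the fixed points.\<close>
  show "e \<oplus> x = e"
    using d_oplus[of "star zero" x] x by (simp add: closed star_zero_oplus)
qed

end

theorem theorem3p12:
  fixes L :: "'a set"
    and oplus :: "'a \<Rightarrow> 'a \<Rightarrow> 'a"
    and star :: "'a \<Rightarrow> 'a"
    and zero :: 'a
    and d :: "'a \<Rightarrow> 'a"
  assumes "mv_algebra L oplus star zero"
    and "mv_derivation L oplus star d"
    and "mv_additive L oplus d"
  shows "mv_algebra (Fix_set L d) oplus (\<lambda>x. d (star x)) zero \<and>
    (\<forall>x\<in>Fix_set L d.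
       d (star x) = mv_odot oplus star (d (mv_one star zero)) (star x) \<and>
       mv_odot oplus star (d (mv_one star zero)) (star x)
         = star (oplus x (star (d (mv_one star zero)))))"
proof -
  interpret mv_additive_derivation L oplus star zero d
    using assms by (simp add: mv_additive_derivation_def mv_additive_derivation_axioms_def)
  show ?thesis
  proof (intro conjI ballI)
    show "mv_algebra (Fix_set L d) oplus (\<lambda>x. d (star x)) zero"
      by (rule Fix_mv_algebra)
  next
    fix x assume "x \<in> Fix_set L d"
    then have x: "x \<in> L"
      by (simp add: Fix_set_def)
    show "d (star x) = mv_odot oplus star (d (mv_one star zero)) (star x)"
      using d_eq_odot[of "star x"] x by (simp add: mv_odot_def mv_one_def closed)
    show "mv_odot oplus star (d (mv_one star zero)) (star x)
        = star (oplus x (star (d (mv_one star zero))))"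
      using x by (simp add: mv_odot_def mv_one_def closed d_closed star_star oplus_comm)
  qed
qed

end
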